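(* For every $F\in C(\mathbb{T},\mathbb{R})$ one has $$J_\Delta(\Delta F)=F-\mathbb{F}_0 \ \text{ on } \mathbb{T},\qquad \Delta(J_\Delta F)=F\ \text{ on } \mathbb{T}_+,$$ $$J_\nabla(\nabla F)=F-\mathbb{F}_0 \ \text{ on } \mathbb{T},\qquad \nabla(J_\nabla F)=F\ \text{ on } \mathbb{T}_-,$$ where $\mathbb{F}_0\in C(\mathbb{T},\mathbb{R})$ is the constant discrete function equal to $F(t_0)$.
   Context: Let $a<b$ be real numbers, $N\ge 1$ an integer, $h=(b-a)/N$, $t_k=a+kh$ for $k=0,\dots,N$, $\mathbb{T}=\{t_0,\dots,t_N\}$, $\mathbb{T}_+=\{t_0,\dots,t_{N-1}\}$, $\mathbb{T}_-=\{t_1,\dots,t_N\}$. For a finite set $S$, $C(S,\mathbb{R})$ is the set of all functions $S\to\mathbb{R}$; write $F_k=F(t_k)$. Discrete derivatives: let $\iota_1(F):[a,b]\to\mathbb{R}$ be the continuous function that is affine on each $[t_k,t_{k+1}]$ and equals $F_k$ at $t_k$. Then $\Delta F\in C(\mathbb{T}_+,\mathbb{R})$ (resp. $\nabla F\in C(\mathbb{T}_-,\mathbb{R})$) is the restriction to $\mathbb{T}_+$ (resp. $\mathbb{T}_-$) of the right (resp. left) derivative of $\iota_1(F)$; explicitly $(\Delta F)_k=(F_{k+1}-F_k)/h$ for $0\le k\le N-1$ and $(\nabla F)_k=(F_k-F_{k-1})/h$ for $1\le k\le N$. Discrete antiderivatives: $J_\Delta F\in C(\mathbb{T},\mathbb{R})$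 (resp. $J_\nabla F$) is the restriction to $\mathbb{T}$ of $t\mapsto\int_a^t \iota_0^{+}(F)(s)\,ds$ (resp. $\int_a^t \iota_0^{-}(F)(s)\,ds$), where $\iota_0^+(F)=\sum_{k=0}^{N-1}F_k 1_{[t_k,t_{k+1}[}$ and $\iota_0^-(F)=\sum_{k=1}^{N}F_k 1_{]t_{k-1},t_k]}$. Explicitly $(J_\Delta F)_k=\sum_{i=0}^{k-1}hF_i$ and $(J_\nabla F)_k=\sum_{i=1}^{k}hF_i$ for $0\le k\le N$ (empty sums are $0$). In particular $J_\Delta$ only uses the values on $\mathbb{T}_+$ and $J_\nabla$ only those on $\mathbb{T}_-$, so they are also defined on $C(\mathbb{T}_+,\mathbb{R})$ and $C(\mathbb{T}_-,\mathbb{R})$ respectively. *)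

theory Defs
  imports "HOL-Analysis.Analysis"
begin

definition step :: "real \<Rightarrow> real \<Rightarrow> nat \<Rightarrow> real" where
  "step a b N = (b - a) / real N"

definition node :: "real \<Rightarrow> real \<Rightarrow> nat \<Rightarrow> nat \<Rightarrow> real" where
  "node a b N k = a + real k * step a b N"

definition grid :: "real \<Rightarrow> real \<Rightarrow> nat \<Rightarrow> real set" where
  "grid a b N = node a b N ` {0..N}"

definition grid_plus :: "real \<Rightarrow> real \<Rightarrow> nat \<Rightarrow> real set" where
  "grid_plus a b N = node a b N ` {0..<N}"

definition grid_minus :: "real \<Rightarrow> real \<Rightarrow> nat \<Rightarrow> real set" where
  "grid_minus a b N = node a b N ` {1..N}"

text \<open>
  A real-valued function on a set \<open>S\<close> of reals is an extensional function, i.e. one that is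
  \<open>undefined\<close> outside \<open>S\<close>. Hence equality of HOL functions is equality as functions on \<open>S\<close>,
  and the restriction of \<open>f\<close> to \<open>S\<close> is \<open>restrict f S\<close>.
\<close>

definition real_funs :: "real set \<Rightarrow> (real \<Rightarrow> real) set" where
  "real_funs S = S \<rightarrow>\<^sub>E UNIV"

definition const_fun :: "real set \<Rightarrow> real \<Rightarrow> real \<Rightarrow> real" where
  "const_fun S c = (\<lambda>t\<in>S. c)"

definition is_interp1 :: "real \<Rightarrow> real \<Rightarrow> nat \<Rightarrow> (real \<Rightarrow> real) \<Rightarrow> (real \<Rightarrow> real) \<Rightarrow> bool" where
  "is_interp1 a b N F G \<longleftrightarrow>
     G \<in> real_funs {a..b} \<and> continuous_on {a..b} G \<and>
     (\<forall>k<N. \<exists>m c. \<forall>t\<in>{node a b N k..node a b N (Suc k)}. G t = m * t + c) \<and>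
     (\<forall>k\<le>N. G (node a b N k) = F (node a b N k))"

definition interp1 :: "real \<Rightarrow> real \<Rightarrow> nat \<Rightarrow> (real \<Rightarrow> real) \<Rightarrow> real \<Rightarrow> real" where
  "interp1 a b N F = (THE G. is_interp1 a b N F G)"

text \<open>The description defining \<open>interp1\<close> is proper:\<close>

lemma ex1_is_interp1:
  assumes "a < b" and "N \<ge> 1"
  shows "\<exists>!G. is_interp1 a b N F G"
proof -
  define h where "h = step a b N"
  define x where "x = node a b N"
  have h: "h > 0" using assms by (simp add: h_def step_def)
  have x: "x k = a + real k * h" for k by (simp add: x_def h_def node_def)
  have xm: "x i \<le> x j" if "i \<le> j" for i j using that h by (simp add: x)
  have xS: "x (Suc k) = x k + h" for k by (simp add: x algebra_simps)
  have x0: "x 0 = a" by (simp add: x)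
  have xN: "x N = b" using assms by (simp add: x h_def step_def)
  have cover: "\<exists>k<N. t \<in> {x k..x (Suc k)}" if t: "t \<in> {a..b}" for t
  proof (cases "t = b")
    case True
    then show ?thesis using assms xN h xS[of "N - 1"] by (intro exI[of _ "N - 1"]) auto
  next
    case False
    define k where "k = nat \<lfloor>(t - a) / h\<rfloor>"
    have "0 \<le> (t - a) / h" using t h by simp
    then have k: "real k \<le> (t - a) / h" "(t - a) / h < real k + 1"
      unfolding k_def by linarith+
    have k': "real k * h \<le> t - a" "t - a < (real k + 1) * h"
      using k h by (simp_all add: field_simps)
    have "x k < x N" using k' False t xN by (simp add: x)
    then have "k < N" using h by (simp add: x)
    then show ?thesis using k' by (intro exI[of _ k]) (auto simp: x algebra_simps)
  qed
  define g where "g t = F (x 0) + (\<Sum>i<N. (F (x (Suc i)) - F (x i)) / h * (min t (x (Suc i)) - min t (x i)))" for t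
  have g: "g t = F (x k) + (F (x (Suc k)) - F (x k)) / h * (t - x k)"
    if k: "k < N" and t: "t \<in> {x k..x (Suc k)}" for k t
  proof -
    have 1: "(\<Sum>i<k. (F (x (Suc i)) - F (x i)) / h * (min t (x (Suc i)) - min t (x i)))
      = (\<Sum>i<k. F (x (Suc i)) - F (x i))"
    proof (rule sum.cong)
      fix i assume "i \<in> {..<k}"
      then have "x (Suc i) \<le> t" "x i \<le> t"
        using t xm[of "Suc i" k] xm[of i k] by auto
      then show "(F (x (Suc i)) - F (x i)) / h * (min t (x (Suc i)) - min t (x i))
        = F (x (Suc i)) - F (x i)"
        using h by (simp add: xS)
    qed simp
    have 2: "(\<Sum>i=Suc k..<N. (F (x (Suc i)) - F (x i)) / h * (min t (x (Suc i)) - min t (x i))) = 0"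
    proof (rule sum.neutral, rule ballI)
      fix i assume "i \<in> {Suc k..<N}"
      then have "t \<le> x (Suc i)" "t \<le> x i"
        using t xm[of "Suc k" "Suc i"] xm[of "Suc k" i] by auto
      then show "(F (x (Suc i)) - F (x i)) / h * (min t (x (Suc i)) - min t (x i)) = 0"
        by simp
    qed
    have split: "sum f {..<N} = sum f {..<k} + f k + sum f {Suc k..<N}" for f :: "nat \<Rightarrow> real"
    proof -
      have "sum f {..<N} = sum f {..<Suc k} + sum f {Suc k..<N}"
        using k sum.atLeastLessThan_concat[of 0 "Suc k" N f] by (simp add: atLeast0LessThan)
      then show ?thesis by simp
    qed
    have 3: "min t (x (Suc k)) - min t (x k) = t - x k" using t by simp
    have "(\<Sum>i<N. (F (x (Suc i)) - F (x i)) / h * (min t (x (Suc i)) - min t (x i)))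
      = (\<Sum>i<k. F (x (Suc i)) - F (x i)) + (F (x (Suc k)) - F (x k)) / h * (t - x k)"
      unfolding split 1 2 3 by simp
    moreover have "(\<Sum>i<k. F (x (Suc i)) - F (x i)) = F (x k) - F (x 0)"
      by (rule sum_lessThan_telescope)
    ultimately show ?thesis by (simp add: g_def)
  qed
  have gx: "g (x k) = F (x k)" if "k \<le> N" for k
  proof (cases k)
    case 0
    then show ?thesis using g[of 0 "x 0"] assms h by (simp add: xS)
  next
    case (Suc j)
    then show ?thesis using g[of j "x k"] that h by (simp add: xS)
  qed
  have "is_interp1 a b N F (restrict g {a..b})"
    unfolding is_interp1_def x_def[symmetric]
  proof (intro conjI allI impI)
    show "restrict g {a..b} \<in> real_funs {a..b}" by (simp add: real_funs_def)
    have "continuous_on {a..b} g"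
      unfolding g_def by (intro continuous_intros)
    then show "continuous_on {a..b} (restrict g {a..b})"
      by (rule continuous_on_eq) simp
  next
    fix k assume k: "k < N"
    have "t \<in> {a..b}" if "t \<in> {x k..x (Suc k)}" for t
      using that k xm[of 0 k] xm[of "Suc k" N] x0 xN by auto
    then have "\<forall>t\<in>{x k..x (Suc k)}. restrict g {a..b} t
      = (F (x (Suc k)) - F (x k)) / h * t
        + (F (x k) - (F (x (Suc k)) - F (x k)) / h * x k)"
      using g[OF k] by (simp add: right_diff_distrib)
    then show "\<exists>m c. \<forall>t\<in>{x k..x (Suc k)}. restrict g {a..b} t = m * t + c" by blast
  next
    fix k assume "k \<le> N"
    then show "restrict g {a..b} (x k) = F (x k)"
      using gx xm[of 0 k] xm[of k N] x0 xN by auto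
  qed
  moreover have "G t = H t"
    if G: "is_interp1 a b N F G" and H: "is_interp1 a b N F H" for G H t
  proof (cases "t \<in> {a..b}")
    case False
    then show ?thesis using G H by (auto simp: is_interp1_def real_funs_def PiE_def extensional_def)
  next
    case True
    then obtain k where k: "k < N" and t: "t \<in> {x k..x (Suc k)}" using cover by blast
    obtain m c where mc: "\<forall>t\<in>{x k..x (Suc k)}. G t = m * t + c"
      using G k unfolding is_interp1_def x_def by blast
    obtain m' c' where mc': "\<forall>t\<in>{x k..x (Suc k)}. H t = m' * t + c'"
      using H k unfolding is_interp1_def x_def by blast
    have e: "G (x j) = H (x j)" if "j \<le> N" for j
      using G H that unfolding is_interp1_def x_def by simp
    have 1: "m * x k + c = m' * x k + c'"
      using mc mc' e[of k] k xm[of k "Suc k"] by simp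
    have 2: "m * x (Suc k) + c = m' * x (Suc k) + c'"
      using mc mc' e[of "Suc k"] k xm[of k "Suc k"] by simp
    have "m * h = m' * h" using 1 2 unfolding xS distrib_left by linarith
    then have "m = m'" using h by simp
    then show ?thesis using 1 mc mc' t by simp
  qed
  ultimately show ?thesis by blast
qed

definition interp0_plus :: "real \<Rightarrow> real \<Rightarrow> nat \<Rightarrow> (real \<Rightarrow> real) \<Rightarrow> real \<Rightarrow> real" where
  "interp0_plus a b N F s =
     (\<Sum>k=0..<N. F (node a b N k) * indicator {node a b N k..<node a b N (Suc k)} s)"

definition interp0_minus :: "real \<Rightarrow> real \<Rightarrow> nat \<Rightarrow> (real \<Rightarrow> real) \<Rightarrow> real \<Rightarrow> real" where
  "interp0_minus a b N F s =
     (\<Sum>k=1..N. F (node a b N k) * indicator {node a b N (k - 1)<..node a b N k} s)"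

text \<open>
  For real functions, \<open>vector_derivative f (at_right t)\<close> and \<open>vector_derivative f (at_left t)\<close>
  are the right and the left derivative of \<open>f\<close> at \<open>t\<close>. The values of \<open>interp1\<close> outside
  the interval from \<open>a\<close> to \<open>b\<close> play no role: right derivatives are taken at points of the
  interval below \<open>b\<close>, left derivatives at points above \<open>a\<close>.
\<close>

definition disc_Delta :: "real \<Rightarrow> real \<Rightarrow> nat \<Rightarrow> (real \<Rightarrow> real) \<Rightarrow> real \<Rightarrow> real" where
  "disc_Delta a b N F =
     (\<lambda>t\<in>grid_plus a b N. vector_derivative (interp1 a b N F) (at_right t))"

definition disc_nabla :: "real \<Rightarrow> real \<Rightarrow> nat \<Rightarrow> (real \<Rightarrow> real) \<Rightarrow> real \<Rightarrow> real" where
  "disc_nabla a b N F =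
     (\<lambda>t\<in>grid_minus a b N. vector_derivative (interp1 a b N F) (at_left t))"

text \<open>
  \<open>J_Delta\<close> evaluates its argument only on \<open>grid_plus\<close> and \<open>J_nabla\<close> only on
  \<open>grid_minus\<close>, so each also applies to functions on that smaller set.
\<close>

definition J_Delta :: "real \<Rightarrow> real \<Rightarrow> nat \<Rightarrow> (real \<Rightarrow> real) \<Rightarrow> real \<Rightarrow> real" where
  "J_Delta a b N F = (\<lambda>t\<in>grid a b N. integral {a..t} (interp0_plus a b N F))"

definition J_nabla :: "real \<Rightarrow> real \<Rightarrow> nat \<Rightarrow> (real \<Rightarrow> real) \<Rightarrow> real \<Rightarrow> real" where
  "J_nabla a b N F = (\<lambda>t\<in>grid a b N. integral {a..t} (interp0_minus a b N F))"

end

theory Submission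
  imports Defs
begin

text \<open>
  On each cell between consecutive nodes the interpolant \<open>interp1\<close> of \<open>F\<close> is affine, so its
  right derivative at the left end and its left derivative at the right end are both the
  difference quotient of \<open>F\<close> over that cell (\<open>disc_Delta_node\<close>, \<open>disc_nabla_node\<close>).
  Up to one endpoint, which an integral ignores, the step functions \<open>interp0_plus\<close> and
  \<open>interp0_minus\<close> are constant on each cell, so integrating them up to a node gives a Riemann
  sum (\<open>J_Delta_node\<close>, \<open>J_nabla_node\<close>).

  The theorem is thereby reduced to the fact that differences and partial sums invert each other:
  the mesh size times a sum of difference quotients telescopes, and the difference of two successive partial
  sums is the last summand. The two variants differ only in the end of the cell to which
  its value is attached.
\<close>

lemma step_pos: "a < b \<Longrightarrow> N \<ge> 1 \<Longrightarrow> step a b N > 0"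
  by (simp add: step_def)

lemma node_0 [simp]: "node a b N 0 = a"
  by (simp add: node_def)

lemma node_Suc: "node a b N (Suc k) = node a b N k + step a b N"
  by (simp add: node_def algebra_simps)

lemma node_mono: "a < b \<Longrightarrow> N \<ge> 1 \<Longrightarrow> i \<le> j \<Longrightarrow> node a b N i \<le> node a b N j"
  using step_pos[of a b N] by (simp add: node_def)

text \<open>
  The defining property of \<open>interp1\<close> only asserts that some slope exists on each cell; the two
  interpolation conditions at the ends of the cell determine it.
\<close>

lemma interp1_affine_on_cell:
  assumes "a < b" and "N \<ge> 1" and "k < N"
  shows "\<exists>c. \<forall>t\<in>{node a b N k..node a b N (Suc k)}. interp1 a b N F t
    = (F (node a b N (Suc k)) - F (node a b N k)) / step a b N * t + c"
proof -
  let ?x = "node a b N" and ?h = "step a b N"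
  have h: "?h > 0" using assms by (simp add: step_pos)
  have *: "is_interp1 a b N F (interp1 a b N F)"
    unfolding interp1_def by (rule theI'[OF ex1_is_interp1[OF assms(1,2)]])
  obtain m c where mc: "\<forall>t\<in>{?x k..?x (Suc k)}. interp1 a b N F t = m * t + c"
    using * assms(3) unfolding is_interp1_def by blast
  have "F (?x k) = interp1 a b N F (?x k)" "F (?x (Suc k)) = interp1 a b N F (?x (Suc k))"
    using * assms(3) unfolding is_interp1_def by simp_all
  moreover have "?x k \<in> {?x k..?x (Suc k)}" "?x (Suc k) \<in> {?x k..?x (Suc k)}"
    using h by (simp_all add: node_Suc)
  ultimately have "F (?x k) = m * ?x k + c" "F (?x (Suc k)) = m * ?x (Suc k) + c"
    using mc by metis+
  then have "m = (F (?x (Suc k)) - F (?x k)) / ?h"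
    using h by (simp add: node_Suc field_simps)
  then show ?thesis using mc by blast
qed

lemma interp1_has_vector_derivative_within_cell:
  assumes "a < b" and "N \<ge> 1" and "k < N" and "t \<in> {node a b N k..node a b N (Suc k)}"
  shows "(interp1 a b N F has_vector_derivative
      (F (node a b N (Suc k)) - F (node a b N k)) / step a b N)
    (at t within {node a b N k..node a b N (Suc k)})"
    (is "(_ has_vector_derivative ?m) _")
proof -
  obtain c where c: "\<forall>t\<in>{node a b N k..node a b N (Suc k)}. interp1 a b N F t = ?m * t + c"
    using interp1_affine_on_cell[OF assms(1-3)] by blast
  have "((\<lambda>t. m * t + c) has_vector_derivative m) (at t within S)" for m S
    unfolding has_real_derivative_iff_has_vector_derivative[symmetric]
    by (rule derivative_eq_intros refl | simp)+
  from has_vector_derivative_transform[OF assms(4) bspec[OF c] this] show ?thesis .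
qed

text \<open>
  One-sided filters at an endpoint of a cell agree with the filter within that cell, so only the
  affine piece there matters for the one-sided derivative.
\<close>

lemma disc_Delta_node:
  assumes "a < b" and "N \<ge> 1" and "k < N"
  shows "disc_Delta a b N F (node a b N k)
    = (F (node a b N (Suc k)) - F (node a b N k)) / step a b N"
proof -
  have less: "node a b N k < node a b N (Suc k)"
    using step_pos[OF assms(1,2)] by (simp add: node_Suc)
  have "vector_derivative (interp1 a b N F) (at_right (node a b N k))
    = (F (node a b N (Suc k)) - F (node a b N k)) / step a b N"
    using interp1_has_vector_derivative_within_cell[OF assms, of "node a b N k" F] less
    by (intro vector_derivative_within) (simp_all add: at_within_Icc_at_right)
  moreover have "node a b N k \<in> grid_plus a b N"
    unfolding grid_plus_def using assms(3) by (intro imageI) simp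
  ultimately show ?thesis by (simp add: disc_Delta_def)
qed

lemma disc_nabla_node:
  assumes "a < b" and "N \<ge> 1" and "k < N"
  shows "disc_nabla a b N F (node a b N (Suc k))
    = (F (node a b N (Suc k)) - F (node a b N k)) / step a b N"
proof -
  have less: "node a b N k < node a b N (Suc k)"
    using step_pos[OF assms(1,2)] by (simp add: node_Suc)
  have "vector_derivative (interp1 a b N F) (at_left (node a b N (Suc k)))
    = (F (node a b N (Suc k)) - F (node a b N k)) / step a b N"
    using interp1_has_vector_derivative_within_cell[OF assms, of "node a b N (Suc k)" F] less
    by (intro vector_derivative_within) (simp_all add: at_within_Icc_at_left)
  moreover have "node a b N (Suc k) \<in> grid_minus a b N"
    unfolding grid_minus_def using assms(3) by (intro imageI) simp
  ultimately show ?thesis by (simp add: disc_nabla_def)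
qed

lemma has_integral_up_to_node:
  fixes g :: "real \<Rightarrow> 'a::banach"
  assumes "a < b" and "N \<ge> 1" and "k \<le> N"
    and "\<And>i. i < N \<Longrightarrow> (g has_integral c i) {node a b N i..node a b N (Suc i)}"
  shows "(g has_integral (\<Sum>i<k. c i)) {a..node a b N k}"
  using assms(3)
proof (induction k)
  case 0
  then show ?case by (simp add: has_integral_refl)
next
  case (Suc k)
  have le: "a \<le> node a b N k" "node a b N k \<le> node a b N (Suc k)"
    using node_mono[OF assms(1,2), of 0 k] node_mono[OF assms(1,2), of k "Suc k"] by simp_all
  have "(g has_integral (\<Sum>i<k. c i)) {a..node a b N k}"
    "(g has_integral c k) {node a b N k..node a b N (Suc k)}"
    using Suc assms(4) by simp_all
  from has_integral_combine[OF le this] show ?case by simp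
qed

text \<open>The intervals in the definition of \<open>interp0_plus\<close> are disjoint, so only one summand survives.\<close>

lemma interp0_plus_on_cell:
  assumes "a < b" and "N \<ge> 1" and "k < N" and "s \<in> {node a b N k..<node a b N (Suc k)}"
  shows "interp0_plus a b N F s = F (node a b N k)"
proof -
  have "i = k" if "s \<in> {node a b N i..<node a b N (Suc i)}" for i
    using that assms(4) node_mono[OF assms(1,2), of "Suc i" k]
      node_mono[OF assms(1,2), of "Suc k" i] by (cases i k rule: linorder_cases) auto
  then have "s \<in> {node a b N i..<node a b N (Suc i)} \<longleftrightarrow> i = k" for i
    using assms(4) by blast
  then show ?thesis
    unfolding interp0_plus_def indicator_def using assms(3) by (simp only:) simp
qed

lemma interp0_minus_on_cell:
  assumes "a < b" and "N \<ge> 1" and "k < N" and "s \<in> {node a b N k<..node a b N (Suc k)}"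
  shows "interp0_minus a b N F s = F (node a b N (Suc k))"
proof -
  have "i = Suc k" if "s \<in> {node a b N (i - 1)<..node a b N i}" for i
    using that assms(4) node_mono[OF assms(1,2), of i k]
      node_mono[OF assms(1,2), of "Suc k" "i - 1"]
    by (cases i "Suc k" rule: linorder_cases) (auto simp: le_diff_conv2)
  then have "s \<in> {node a b N (i - 1)<..node a b N i} \<longleftrightarrow> i = Suc k" for i
    using assms(4) by (metis diff_Suc_1)
  then show ?thesis
    unfolding interp0_minus_def indicator_def using assms(3) by (simp only:) simp
qed

text \<open>
  The exceptional set \<open>S\<close> absorbs the one endpoint of the closed cell at which a step function
  need not have its value on that cell: the right end for \<open>interp0_plus\<close>, the left
  end for \<open>interp0_minus\<close>.
\<close>

lemma has_integral_const_on_cell: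
  assumes "a < b" and "N \<ge> 1" and "finite S"
    and "\<And>s. s \<in> {node a b N k..node a b N (Suc k)} - S \<Longrightarrow> g s = (c :: real)"
  shows "(g has_integral step a b N * c) {node a b N k..node a b N (Suc k)}"
proof (rule has_integral_spike_finite[OF assms(3)])
  show "((\<lambda>_. c) has_integral step a b N * c) {node a b N k..node a b N (Suc k)}"
    using has_integral_const_real[of c "node a b N k" "node a b N (Suc k)"]
      step_pos[OF assms(1,2)] by (simp add: node_Suc)
qed (use assms(4) in auto)

text \<open>
  Both Riemann sums are indexed by cells rather than by nodes, so that the values of \<open>F\<close> at the
  right ends appear as \<open>Suc i\<close> and one telescoping identity serves both variants.
\<close>

lemma J_Delta_node:
  assumes "a < b" and "N \<ge> 1" and "k \<le> N"
  shows "J_Delta a b N F (node a b N k) = (\<Sum>i<k. step a b N * F (node a b N i))"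
proof -
  have "(interp0_plus a b N F has_integral step a b N * F (node a b N i))
      {node a b N i..node a b N (Suc i)}" if "i < N" for i
    using assms(1,2) that
    by (intro has_integral_const_on_cell[where S = "{node a b N (Suc i)}"] interp0_plus_on_cell) auto
  then have "(interp0_plus a b N F has_integral (\<Sum>i<k. step a b N * F (node a b N i))) {a..node a b N k}"
    by (rule has_integral_up_to_node[OF assms])
  moreover have "node a b N k \<in> grid a b N"
    unfolding grid_def using assms(3) by (intro imageI) simp
  ultimately show ?thesis by (simp add: J_Delta_def integral_unique)
qed

lemma J_nabla_node:
  assumes "a < b" and "N \<ge> 1" and "k \<le> N"
  shows "J_nabla a b N F (node a b N k) = (\<Sum>i<k. step a b N * F (node a b N (Suc i)))"
proof -
  have "(interp0_minus a b N F has_integral step a b N * F (node a b N (Suc i)))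
      {node a b N i..node a b N (Suc i)}" if "i < N" for i
    using assms(1,2) that
    by (intro has_integral_const_on_cell[where S = "{node a b N i}"] interp0_minus_on_cell) auto
  then have "(interp0_minus a b N F has_integral (\<Sum>i<k. step a b N * F (node a b N (Suc i)))) {a..node a b N k}"
    by (rule has_integral_up_to_node[OF assms])
  moreover have "node a b N k \<in> grid a b N"
    unfolding grid_def using assms(3) by (intro imageI) simp
  ultimately show ?thesis by (simp add: J_nabla_def integral_unique)
qed

theorem theorem24:
  fixes a b :: real and N :: nat and F :: "real \<Rightarrow> real"
  assumes "a < b" and "N \<ge> 1" and "F \<in> real_funs (grid a b N)"
  shows "(\<forall>t\<in>grid a b N. J_Delta a b N (disc_Delta a b N F) t
            = F t - const_fun (grid a b N) (F (node a b N 0)) t)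
       \<and> (\<forall>t\<in>grid_plus a b N. disc_Delta a b N (J_Delta a b N F) t = F t)
       \<and> (\<forall>t\<in>grid a b N. J_nabla a b N (disc_nabla a b N F) t
            = F t - const_fun (grid a b N) (F (node a b N 0)) t)
       \<and> (\<forall>t\<in>grid_minus a b N. disc_nabla a b N (J_nabla a b N F) t = F t)"
proof (intro conjI ballI)
  let ?x = "node a b N" and ?h = "step a b N"
  have h: "?h > 0" using assms by (simp add: step_pos)
  have telescope: "(\<Sum>i<k. ?h * ((F (?x (Suc i)) - F (?x i)) / ?h)) = F (?x k) - F (?x 0)" for k
    using h sum_lessThan_telescope[of "\<lambda>i. F (?x i)" k] by simp
  fix t
  {
    assume t: "t \<in> grid a b N"
    then obtain k where k: "k \<le> N" "t = ?x k" by (auto simp: grid_def)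
    have "J_Delta a b N (disc_Delta a b N F) t
      = (\<Sum>i<k. ?h * ((F (?x (Suc i)) - F (?x i)) / ?h))"
      using assms(1,2) k by (simp add: J_Delta_node disc_Delta_node)
    then show "J_Delta a b N (disc_Delta a b N F) t
      = F t - const_fun (grid a b N) (F (?x 0)) t"
      unfolding telescope using t k(2) by (simp add: const_fun_def)
    have "J_nabla a b N (disc_nabla a b N F) t
      = (\<Sum>i<k. ?h * ((F (?x (Suc i)) - F (?x i)) / ?h))"
      using assms(1,2) k by (simp add: J_nabla_node disc_nabla_node)
    then show "J_nabla a b N (disc_nabla a b N F) t
      = F t - const_fun (grid a b N) (F (?x 0)) t"
      unfolding telescope using t k(2) by (simp add: const_fun_def)
  next
    assume "t \<in> grid_plus a b N"
    then obtain k where "k < N" "t = ?x k" by (auto simp: grid_plus_def)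
    then show "disc_Delta a b N (J_Delta a b N F) t = F t"
      using assms(1,2) h by (simp add: J_Delta_node disc_Delta_node)
  next
    assume "t \<in> grid_minus a b N"
    then obtain j where "j \<in> {1..N}" "t = ?x j" by (auto simp: grid_minus_def)
    then have "j - 1 < N" "t = ?x (Suc (j - 1))" by auto
    then obtain k where "k < N" "t = ?x (Suc k)" by blast
    then show "disc_nabla a b N (J_nabla a b N F) t = F t"
      using assms(1,2) h by (simp add: J_nabla_node disc_nabla_node)
  }
qed

end
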